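(* Let $s,y,z$ be indeterminates, let $(\alpha_n)_{n\ge0}$ be defined by $\sum_{n\ge0}\alpha_nx^n=\frac{1+zx}{1+yx+x^2}$, and let $$g=\frac{-2zx^2-(sx-x^2y-1)-\sqrt{(sx-x^2y-1)^2-(2x^2)^2}}{2x^2\left(x^2+x^2z^2+z(sx-x^2y-1)\right)}.$$ Then $g=\mathbf{J}[\mathbf{u}/\mathbf{v}]$ with $u_{2k+1}=-s$, $u_{2k+2}=0$, $v_0=1$, $v_{2k+1}=\alpha_{k+1}/\alpha_k$, $v_{2k+2}=\alpha_k/\alpha_{k+1}$ for all $k\ge0$, i.e. $$g=\cfrac{1}{1-sx-\cfrac{\frac{\alpha_1}{\alpha_0}x^2}{1-\cfrac{\frac{\alpha_0}{\alpha_1}x^2}{1-sx-\cfrac{\frac{\alpha_2}{\alpha_1}x^2}{1-\cdots}}}}.$$ Consequently $H_{2k}(g)=H_{2k+1}(g)=\alpha_k$ for all $k\ge0$.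
   Context: Formal power series in $x$ with coefficients rational functions of $s,y,z$; the square root has constant term $1$. $\mathbf{J}[\mathbf{u}/\mathbf{v}]$ denotes $\cfrac{v_0}{1+u_1x-\cfrac{v_1x^2}{1+u_2x-\cdots}}$. For $g=\sum a_ix^i$, $H_n(g)=\det(a_{i+j})_{0\le i,j\le n-1}$ for $n\ge1$ and $H_0(g)=1$. *)

theory Defs
  imports
    "HOL-Computational_Algebra.Computational_Algebra"
    "Jordan_Normal_Form.Determinant"
begin

instance fract :: ("{idom, ring_char_0}") field_char_0
proof
  show "inj (of_nat :: nat \<Rightarrow> 'a fract)"
    by (rule injI) (simp add: of_nat_fract eq_fract)
qed

section \<open>Three indeterminates\<close>

text \<open>
  The coefficient field \<open>K(s,y,z)\<close> is the fraction field of \<open>K[z][y][s]\<close>.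
\<close>

definition indet_s :: "'a::field poly poly poly fract" where
  "indet_s = Fract [:0, 1:] 1"

definition indet_y :: "'a::field poly poly poly fract" where
  "indet_y = Fract [:[:0, 1:]:] 1"

definition indet_z :: "'a::field poly poly poly fract" where
  "indet_z = Fract [:[:[:0, 1:]:]:] 1"

section \<open>Hankel determinants\<close>

text \<open>For \<open>n = 0\<close> this is the determinant of the empty matrix, which is \<open>1\<close>.\<close>

definition hankel_det :: "nat \<Rightarrow> 'a::comm_ring_1 fps \<Rightarrow> 'a" where
  "hankel_det n g = det (mat n n (\<lambda>(i, j). fps_nth g (i + j)))"

lemma hankel_det_0: "hankel_det 0 g = 1"
  by (simp add: hankel_det_def)

section \<open>J-fractions\<close>

text \<open>
  The value of the infinite continued fraction is the limit, in the \<open>X\<close>-adic topology on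
  formal power series, of the fractions obtained by replacing the \<open>n\<close>-th tail by \<open>0\<close>.
  The entry \<open>u 0\<close> is never used.
\<close>

primrec J_approx :: "nat \<Rightarrow> (nat \<Rightarrow> 'a::field) \<Rightarrow> (nat \<Rightarrow> 'a) \<Rightarrow> 'a fps" where
  "J_approx 0 u v = 0"
| "J_approx (Suc n) u v =
     fps_const (v 0) /
       (1 + fps_const (u 1) * fps_X - fps_X\<^sup>2 * J_approx n (\<lambda>i. u (Suc i)) (\<lambda>i. v (Suc i)))"

definition J_fraction :: "(nat \<Rightarrow> 'a::field) \<Rightarrow> (nat \<Rightarrow> 'a) \<Rightarrow> 'a fps" where
  "J_fraction u v = lim (\<lambda>n. J_approx n u v)"

lemma J_approx_diff_dvd: "fps_X ^ (2 * n) dvd J_approx (n + m) u v - J_approx n u v"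
proof (induction n arbitrary: u v)
  case (Suc n)
  let ?u = "\<lambda>i. u (Suc i)" and ?v = "\<lambda>i. v (Suc i)"
  let ?A = "1 + fps_const (u 1) * fps_X - fps_X\<^sup>2 * J_approx (n + m) ?u ?v"
  let ?B = "1 + fps_const (u 1) * fps_X - fps_X\<^sup>2 * J_approx n ?u ?v"
  have A0: "fps_nth ?A 0 = 1" and B0: "fps_nth ?B 0 = 1"
    by (simp_all add: power2_eq_square)
  have inv: "?A * inverse ?A = 1" "?B * inverse ?B = 1"
    using A0 B0 by (simp_all add: inverse_mult_eq_1')
  have "inverse ?A - inverse ?B = inverse ?A * (?B * inverse ?B) - (?A * inverse ?A) * inverse ?B"
    by (simp only: inv mult_1_right mult_1_left)
  also have "\<dots> = (?B - ?A) * (inverse ?A * inverse ?B)"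
    by (simp add: algebra_simps)
  also have "?B - ?A = fps_X\<^sup>2 * (J_approx (n + m) ?u ?v - J_approx n ?u ?v)"
    by (simp add: algebra_simps)
  finally have inv_diff: "inverse ?A - inverse ?B =
      (fps_X\<^sup>2 * (J_approx (n + m) ?u ?v - J_approx n ?u ?v)) * (inverse ?A * inverse ?B)" .
  have "fps_nth ?A 0 \<noteq> 0" "fps_nth ?B 0 \<noteq> 0"
    using A0 B0 by simp_all
  then have "J_approx (Suc n + m) u v - J_approx (Suc n) u v =
      fps_const (v 0) * (inverse ?A - inverse ?B)"
    by (simp only: add_Suc J_approx.simps fps_divide_unit right_diff_distrib not_False_eq_True)
  also have "\<dots> = (fps_X\<^sup>2 * (J_approx (n + m) ?u ?v - J_approx n ?u ?v)) *
        (fps_const (v 0) * (inverse ?A * inverse ?B))"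
    unfolding inv_diff by (simp only: ac_simps)
  finally have eq: "J_approx (Suc n + m) u v - J_approx (Suc n) u v = \<dots>" .
  have "fps_X\<^sup>2 * fps_X ^ (2 * n) dvd fps_X\<^sup>2 * (J_approx (n + m) ?u ?v - J_approx n ?u ?v)"
    by (rule mult_dvd_mono) (use Suc.IH in auto)
  moreover have "(fps_X :: 'a fps) ^ (2 * Suc n) = fps_X\<^sup>2 * fps_X ^ (2 * n)"
    by (simp add: power2_eq_square)
  ultimately show ?case
    unfolding eq by (metis dvd_mult2)
qed simp

lemma J_approx_tendsto: "(\<lambda>n. J_approx n u v) \<longlonglongrightarrow> J_fraction u v"
proof -
  define G where "G = Abs_fps (\<lambda>i. fps_nth (J_approx (Suc i) u v) i)"
  have "(\<lambda>n. J_approx n u v) \<longlonglongrightarrow> G"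
  proof (rule tendsto_fpsI)
    fix i
    have "fps_nth (J_approx n u v) i = fps_nth G i" if n: "n \<ge> Suc i" for n
    proof -
      have "fps_X ^ (2 * Suc i) dvd J_approx (Suc i + (n - Suc i)) u v - J_approx (Suc i) u v"
        by (rule J_approx_diff_dvd)
      then obtain h where "J_approx n u v - J_approx (Suc i) u v = fps_X ^ (2 * Suc i) * h"
        using n by (auto simp del: J_approx.simps elim!: dvdE)
      then have "fps_nth (J_approx n u v - J_approx (Suc i) u v) i = 0"
        by (simp only: fps_X_power_mult_nth) simp
      then show ?thesis
        by (simp add: G_def del: J_approx.simps)
    qed
    then show "eventually (\<lambda>n. fps_nth (J_approx n u v) i = fps_nth G i) sequentially"
      using eventually_sequentially by blast
  qed
  then show ?thesis
    unfolding J_fraction_def using limI by blast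
qed

section \<open>Well-definedness of the expressions in the theorem\<close>

text \<open>Since division by \<open>0\<close> is total in HOL, we check that all divisions are exact.\<close>

lemma indet_z_nonzero: "indet_z \<noteq> 0"
  by (simp add: indet_z_def Zero_fract_def eq_fract)

lemma sqrt_with_constant_term_1:
  fixes f :: "'a::field_char_0 fps"
  assumes "fps_nth f 0 = 1"
  shows "(fps_radical (\<lambda>_ _. 1) 2 f)\<^sup>2 = f" "fps_nth (fps_radical (\<lambda>_ _. 1) 2 f) 0 = 1"
  using power_radical[of f "\<lambda>_ _. 1" 1] assms by (simp_all add: numeral_2_eq_2)

lemma g_quotient_exact:
  fixes s y z :: "'a::field_char_0"
  assumes z: "z \<noteq> 0"
  defines "X \<equiv> fps_X :: 'a fps" and "S \<equiv> fps_const s" and "Y \<equiv> fps_const y" and "Z \<equiv> fps_const z"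
  defines "num \<equiv> - 2 * Z * X\<^sup>2 - (S * X - X\<^sup>2 * Y - 1)
      - fps_radical (\<lambda>_ _. 1) 2 ((S * X - X\<^sup>2 * Y - 1)\<^sup>2 - (2 * X\<^sup>2)\<^sup>2)"
  defines "den \<equiv> 2 * X\<^sup>2 * (X\<^sup>2 + X\<^sup>2 * Z\<^sup>2 + Z * (S * X - X\<^sup>2 * Y - 1))"
  shows "den \<noteq> 0" "num / den * den = num"
proof -
  define P where "P = 1 - S * X + X\<^sup>2 * Y"
  define R where "R = fps_radical (\<lambda>_ _. 1) 2 ((S * X - X\<^sup>2 * Y - 1)\<^sup>2 - (2 * X\<^sup>2)\<^sup>2)"
  define D where "D = X\<^sup>2 + X\<^sup>2 * Z\<^sup>2 + Z * (S * X - X\<^sup>2 * Y - 1)"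
  have D0: "fps_nth D 0 = - z"
    by (simp add: D_def X_def S_def Y_def Z_def power2_eq_square)
  have c: "fps_nth ((S * X - X\<^sup>2 * Y - 1)\<^sup>2 - (2 * X\<^sup>2)\<^sup>2) 0 = 1"
    by (simp add: X_def S_def Y_def power2_eq_square)
  have R2: "R\<^sup>2 = (S * X - X\<^sup>2 * Y - 1)\<^sup>2 - (2 * X\<^sup>2)\<^sup>2" and R0: "fps_nth R 0 = 1"
    using sqrt_with_constant_term_1[OF c] by (simp_all add: R_def)
  have "(P + R) * (P - R) = P\<^sup>2 - R\<^sup>2"
    by (simp add: power2_eq_square algebra_simps)
  also have "\<dots> = X\<^sup>2 * (4 * X\<^sup>2)"
    unfolding R2 P_def by (simp add: power2_eq_square algebra_simps)
  finally have "X\<^sup>2 dvd (P + R) * (P - R)"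
    by simp
  moreover have "fps_nth (P + R) 0 \<noteq> 0"
    by (simp add: R0 P_def X_def S_def Y_def power2_eq_square)
  ultimately have "X\<^sup>2 dvd P - R"
    by (metis fps_is_unit_iff dvd_mult_unit_iff' mult.commute)
  moreover have "num = (P - R) - 2 * Z * X\<^sup>2"
    by (simp add: num_def P_def R_def)
  ultimately have "X\<^sup>2 dvd num"
    by simp
  moreover have unit: "is_unit (2 * D)"
    using D0 z by simp
  moreover have den: "den = (2 * D) * X\<^sup>2"
    by (simp add: den_def D_def algebra_simps)
  ultimately have "den dvd num"
    by (simp add: mult_unit_dvd_iff')
  then show "num / den * den = num"
    by simp
  show "den \<noteq> 0"
    using D0 z by (auto simp: den X_def)
qed

lemma alpha_nonzero:
  fixes \<alpha> :: "nat \<Rightarrow> 'a::field poly poly poly fract"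
  assumes \<alpha>: "Abs_fps \<alpha> =
    (1 + fps_const indet_z * fps_X) / (1 + fps_const indet_y * fps_X + fps_X\<^sup>2)"
  shows "\<alpha> k \<noteq> 0"
proof -
  let ?D = "1 + fps_const indet_y * fps_X + fps_X\<^sup>2 :: 'a poly poly poly fract fps"
  have unit: "fps_nth ?D 0 \<noteq> 0"
    by (simp add: power2_eq_square)
  have eq: "Abs_fps \<alpha> * ?D = 1 + fps_const indet_z * fps_X"
    unfolding \<alpha> using unit by (intro dvd_div_mult_self) simp
  then have eq: "Abs_fps \<alpha> + fps_const indet_y * (fps_X * Abs_fps \<alpha>) + fps_X ^ 2 * Abs_fps \<alpha> =
      1 + fps_const indet_z * fps_X"
    by (simp add: algebra_simps)
  have nth: "\<alpha> n + indet_y * (if n = 0 then 0 else \<alpha> (n - 1)) + (if n < 2 then 0 else \<alpha> (n - 2))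
      = (if n = 0 then 1 else 0) + (if n = 0 then 0 else fps_nth (fps_const indet_z) (n - 1))" for n
    using arg_cong[OF eq, of "\<lambda>f. fps_nth f n"]
    by (simp add: fps_X_power_mult_nth del: power_Suc split del: if_split cong: if_cong)
  have a0: "\<alpha> 0 = 1"
    using nth[of 0] by simp
  have a1: "\<alpha> 1 = indet_z - indet_y"
    using nth[of 1] a0 by (simp add: eq_diff_eq)
  have rec: "\<alpha> (Suc (Suc n)) = - indet_y * \<alpha> (Suc n) - \<alpha> n" for n
    using nth[of "Suc (Suc n)"] by (simp add: eq_neg_iff_add_eq_0 algebra_simps)
  define R where "R = (\<lambda>n p. p \<noteq> (0 :: 'a poly poly) \<and> degree p = n \<and> \<alpha> n = Fract [:p:] 1)"
  have "(\<exists>p. R n p) \<and> (\<exists>q. R (Suc n) q)" for n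
  proof (induction n)
    case 0
    have "R 0 1"
      by (simp add: R_def a0 One_fract_def one_pCons)
    moreover have "R 1 [:[:0, 1:], -1:]"
      using a1 by (simp add: R_def indet_z_def indet_y_def)
    ultimately show ?case by auto
  next
    case (Suc n)
    then obtain p q where p: "R n p" and q: "R (Suc n) q" by blast
    have q0: "q \<noteq> 0" and dq: "degree q = Suc n" and aq: "\<alpha> (Suc n) = Fract [:q:] 1"
      and dp: "degree p = n" and ap: "\<alpha> n = Fract [:p:] 1"
      using p q by (simp_all add: R_def)
    have "degree (- pCons 0 q) = Suc (Suc n)"
      using q0 dq by simp
    moreover from this have "degree (- pCons 0 q + - p) = degree (- pCons 0 q)"
      using dp by (intro degree_add_eq_left) simp
    ultimately have deg: "degree (- pCons 0 q + - p) = Suc (Suc n)"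
      by simp
    then have ne: "- pCons 0 q + - p \<noteq> 0"
      by force
    have "\<alpha> (Suc (Suc n)) = Fract [:- pCons 0 q + - p:] 1"
      unfolding rec[of n] aq ap indet_y_def by simp
    with deg ne have "R (Suc (Suc n)) (- pCons 0 q + - p)"
      unfolding R_def by blast
    with q show ?case by blast
  qed
  then obtain p where "R k p" by blast
  then show ?thesis
    by (auto simp: R_def Zero_fract_def eq_fract)
qed

end

theory Submission
  imports Defs
begin

text \<open>
  Put \<open>P = 1 - s x + x\<^sup>2 y\<close>, let \<open>R\<close> be the square root and \<open>V = 2 / (P + R)\<close>. Then
  \<open>V (P - x\<^sup>4 V) = 1\<close>, which turns \<open>g\<close> into \<open>G(z)\<close>, where \<open>G(c) = V / (1 - c x\<^sup>2 V)\<close>. This family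
  reproduces itself after two steps of the continued fraction: with \<open>r = c - y\<close>,
  \<open>G(c) = 1 / (1 - s x - x\<^sup>2 (r + x\<^sup>2 V))\<close> and \<open>r + x\<^sup>2 V = r / (1 - x\<^sup>2 r\<^sup>-\<^sup>1 G(- 1 / r))\<close>.
  Starting from \<open>c = z\<close>, the recurrence of \<open>\<alpha>\<close> makes the \<open>k\<close>-th value of \<open>r\<close> equal to
  \<open>\<alpha>\<^sub>k\<^sub>+\<^sub>1 / \<alpha>\<^sub>k\<close>. The Hankel determinants are \<open>H\<^sub>n = \<Prod>i<n. v\<^sub>i ^ (n - i)\<close>, which telescopes.
\<close>

section \<open>J-fractions and Hankel determinants\<close>

text \<open>Each level carries a factor \<open>x^2\<close>, so replacing the \<open>n\<close>-th
  tail by \<open>0\<close> changes the series only from degree \<open>2 * n\<close> on. Any sequence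
  of tails obeying the one-level equation therefore pins down the limit of the approximants.\<close>

lemma J_fraction_eqI:
  fixes f :: "nat \<Rightarrow> 'a::field fps"
  assumes "\<And>i. f i * (1 + fps_const (u (Suc i)) * fps_X - fps_X\<^sup>2 * f (Suc i)) = fps_const (v i)"
  shows "f 0 = J_fraction u v"
proof -
  have dvd: "fps_X ^ (2 * n) dvd f 0 - J_approx n u v" for n
    using assms
  proof (induction n arbitrary: f u v)
    case (Suc n)
    define J where "J = J_approx n (\<lambda>i. u (Suc i)) (\<lambda>i. v (Suc i))"
    define A where "A = 1 + fps_const (u 1) * fps_X - fps_X\<^sup>2 * f 1"
    define B where "B = 1 + fps_const (u 1) * fps_X - fps_X\<^sup>2 * J"
    have A0: "fps_nth A 0 = 1" and B0: "fps_nth B 0 = 1"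
      by (simp_all add: A_def B_def power2_eq_square)
    have fA: "f 0 * A = fps_const (v 0)"
      using Suc.prems[of 0] by (simp add: A_def)
    have "J_approx (Suc n) u v = fps_const (v 0) / B"
      by (simp add: B_def J_def)
    then have JB: "J_approx (Suc n) u v * B = fps_const (v 0)"
      using B0 by simp
    have "fps_X ^ (2 * n) dvd f 1 - J"
      using Suc.IH[of "\<lambda>i. f (Suc i)" "\<lambda>i. u (Suc i)" "\<lambda>i. v (Suc i)"] Suc.prems[of "Suc _"]
      by (simp add: J_def)
    then have "fps_X\<^sup>2 * fps_X ^ (2 * n) dvd fps_const (v 0) * (fps_X\<^sup>2 * (f 1 - J))"
      by (intro dvd_mult mult_dvd_mono) auto
    also have "fps_const (v 0) * (fps_X\<^sup>2 * (f 1 - J)) = fps_const (v 0) * (B - A)"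
      by (simp add: A_def B_def algebra_simps)
    \<comment> \<open>Cross-multiplying replaces inverses by the factor \<open>A * B\<close>, a unit
      because both constant terms are \<open>1\<close>.\<close>
    also have "\<dots> = (f 0 * A) * B - (J_approx (Suc n) u v * B) * A"
      unfolding fA JB by (simp add: algebra_simps)
    also have "\<dots> = (f 0 - J_approx (Suc n) u v) * (A * B)"
      by (simp add: algebra_simps del: J_approx.simps)
    finally have "fps_X ^ (2 * Suc n) dvd (f 0 - J_approx (Suc n) u v) * (A * B)"
      by (simp add: power2_eq_square mult.assoc del: J_approx.simps)
    moreover have "is_unit (A * B)"
      using A0 B0 by simp
    ultimately show ?case
      using dvd_mult_unit_iff by blast
  qed simp
  have "(\<lambda>n. J_approx n u v) \<longlonglongrightarrow> f 0"
  proof (rule tendsto_fpsI)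
    fix i
    have "fps_nth (J_approx n u v) i = fps_nth (f 0) i" if "n \<ge> Suc i" for n
    proof -
      obtain h where "f 0 - J_approx n u v = fps_X ^ (2 * n) * h"
        using dvd by (auto elim!: dvdE)
      then have "fps_nth (f 0 - J_approx n u v) i = 0"
        using that by (simp only: fps_X_power_mult_nth) simp
      then show ?thesis
        by simp
    qed
    then show "eventually (\<lambda>n. fps_nth (J_approx n u v) i = fps_nth (f 0) i) sequentially"
      using eventually_sequentially by blast
  qed
  then show ?thesis
    using J_approx_tendsto LIMSEQ_unique by blast
qed

section \<open>Hankel matrices across one continued fraction level\<close>

lemma fps_X_mult_mult_nth:
  fixes p q :: "'a::comm_ring_1 fps"
  shows "fps_nth (fps_X * (p * q)) n = (\<Sum>b<n. fps_nth p b * fps_nth q (n - 1 - b))"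
  by (cases n) (simp_all add: fps_mult_nth[of p q] atLeast0AtMost lessThan_Suc_atMost)

text \<open>A generating function for row \<open>i\<close> of the matrix factorisation below: the
  bracket collects row \<open>i\<close> of \<open>L (1 \<oplus> H)\<close>, and the factor
  \<open>e\<close> accounts for the transpose of \<open>L\<close>. Repeatedly dropping the lowest
  coefficient of \<open>e\<close> proves it.\<close>

lemma fps_shift_J_step:
  fixes e h :: "'a::comm_ring_1 fps"
  assumes e: "e * (1 + fps_const c * fps_X - fps_X\<^sup>2 * h) = 1"
  shows "fps_shift i e =
    e * (fps_const (fps_nth e i) + fps_X * (\<Sum>a<i. fps_const (fps_nth e (i - 1 - a)) * fps_shift a h))"
proof -
  have e_eq: "e = 1 - fps_X * (fps_const c * e - fps_X * (h * e))"
    using e by (simp add: algebra_simps power2_eq_square)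
  have e0: "fps_nth e 0 = 1"
    by (subst e_eq) simp
  have shift1: "fps_shift 1 e = fps_X * h * e - fps_const c * e"
    by (rule fps_ext, subst (1) e_eq) (simp add: mult.assoc)
  have rec: "fps_nth e (Suc i) + c * fps_nth e i = (\<Sum>a<i. fps_nth e (i - 1 - a) * fps_nth h a)" for i
  proof -
    have "fps_nth e (Suc i) = fps_nth (fps_X * (h * e)) i - c * fps_nth e i"
      using arg_cong[OF shift1, of "\<lambda>f. fps_nth f i"] by (simp add: mult.assoc)
    moreover have "fps_nth (fps_X * (h * e)) i = (\<Sum>a<i. fps_nth e (i - 1 - a) * fps_nth h a)"
      unfolding fps_X_mult_mult_nth by (simp add: mult.commute)
    ultimately show ?thesis
      by simp
  qed
  show ?thesis
  proof (induction i)
    case 0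
    then show ?case by (simp add: e0)
  next
    case (Suc i)
    \<comment> \<open>\<open>T 0\<close> is the inner sum for \<open>i\<close>; \<open>T 1\<close>
      is what remains of it, up to a factor \<open>x\<close>, once the constant terms of the shifted
      \<open>h\<close> are split off.\<close>
    define T where "T j = (\<Sum>a<i. fps_const (fps_nth e (i - 1 - a)) * fps_shift (a + j) h)" for j
    have h_eq: "fps_shift a h = fps_const (fps_nth h a) + fps_X * fps_shift (a + 1) h" for a
      by (rule fps_ext) (auto simp: fps_X_mult_nth)
    have T: "T 0 = fps_const (fps_nth e (Suc i) + c * fps_nth e i) + fps_X * T 1"
    proof -
      have "T 0 = (\<Sum>a<i. fps_const (fps_nth e (i - 1 - a) * fps_nth h a)
          + fps_X * (fps_const (fps_nth e (i - 1 - a)) * fps_shift (a + 1) h))"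
        unfolding T_def
        by (rule sum.cong, simp, subst h_eq) (simp add: algebra_simps flip: fps_const_mult)
      also have "\<dots> = fps_const (fps_nth e (Suc i) + c * fps_nth e i) + fps_X * T 1"
        unfolding rec T_def sum.distrib sum_distrib_left
        by (rule arg_cong2[where f = "(+)"]) (auto simp: fps_eq_iff fps_sum_nth)
      finally show ?thesis .
    qed
    have "fps_shift (Suc i) e = fps_shift 1 (fps_shift i e)"
      by (rule fps_ext) simp
    also have "fps_shift i e = fps_const (fps_nth e i) * e + fps_X * (e * T 0)"
      unfolding Suc.IH T_def by (simp add: algebra_simps)
    also have "fps_shift 1 \<dots> = fps_const (fps_nth e i) * fps_shift 1 e + e * T 0"
      by (rule fps_ext) simp
    \<comment> \<open>The \<open>c\<close> terms from \<open>shift1\<close> and from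
      \<open>T\<close> cancel. What is left contains the next inner sum, with \<open>h\<close> times
      the \<open>i\<close>-th coefficient as its new term at \<open>a = 0\<close>.\<close>
    also have "\<dots> = e * (fps_const (fps_nth e (Suc i))
        + fps_X * (fps_const (fps_nth e i) * h + T 1))"
      unfolding shift1 T by (simp add: algebra_simps flip: fps_const_add fps_const_mult)
    also have "fps_const (fps_nth e i) * h + T 1 =
        (\<Sum>a<Suc i. fps_const (fps_nth e (Suc i - 1 - a)) * fps_shift a h)"
      by (subst sum.lessThan_Suc_shift) (simp add: T_def)
    finally show ?case .
  qed
qed

lemma fps_nth_add_J_step:
  fixes e h :: "'a::comm_ring_1 fps"
  assumes "e * (1 + fps_const c * fps_X - fps_X\<^sup>2 * h) = 1"
  shows "fps_nth e (i + j) = fps_nth e i * fps_nth e j +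
    (\<Sum>a<i. \<Sum>b<j. fps_nth e (i - 1 - a) * fps_nth h (a + b) * fps_nth e (j - 1 - b))"
proof -
  have nth: "fps_nth (e * (fps_X * q)) j = (\<Sum>b<j. fps_nth q b * fps_nth e (j - 1 - b))" for q
    using fps_X_mult_mult_nth[of q e j] by (simp add: ac_simps)
  have "fps_nth e (i + j) = fps_nth (fps_shift i e) j"
    by (simp add: add.commute)
  also have "\<dots> = fps_nth e i * fps_nth e j + (\<Sum>b<j. \<Sum>a<i.
      fps_nth e (i - 1 - a) * fps_nth h (a + b) * fps_nth e (j - 1 - b))"
    unfolding fps_shift_J_step[OF assms, of i] distrib_left fps_add_nth nth
    by (simp add: fps_sum_nth sum_distrib_left ac_simps)
  finally show ?thesis
    by (subst sum.swap)
qed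

text \<open>
  With \<open>e = 1 / (1 + c x - x\<^sup>2 h)\<close> and \<open>L\<close> the unitriangular Toeplitz matrix of \<open>e\<close>, the Hankel
  matrix of \<open>e\<close> factors as \<open>L (1 \<oplus> H) L\<^sup>T\<close>, where \<open>H\<close> is the Hankel matrix of \<open>h\<close>.
\<close>

lemma hankel_det_inverse_J_step:
  fixes e h :: "'a::idom fps"
  assumes e: "e * (1 + fps_const c * fps_X - fps_X\<^sup>2 * h) = 1"
  shows "hankel_det (Suc n) e = hankel_det n h"
proof -
  define L where "L = mat (Suc n) (Suc n) (\<lambda>(i, j). if j \<le> i then fps_nth e (i - j) else 0)"
  define H where "H = mat n n (\<lambda>(i, j). fps_nth h (i + j))"
  define B where "B = four_block_mat (1\<^sub>m 1) (0\<^sub>m 1 n) (0\<^sub>m n 1) H"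
  have carr: "L \<in> carrier_mat (Suc n) (Suc n)" "H \<in> carrier_mat n n" "B \<in> carrier_mat (Suc n) (Suc n)"
    by (auto simp: L_def H_def B_def)
  have "fps_nth e 0 = 1"
    using arg_cong[OF e, of "\<lambda>f. fps_nth f 0"] by (simp add: power2_eq_square)
  then have detL: "det L = 1"
    by (subst det_lower_triangular[where n = "Suc n"])
       (auto simp: L_def prod_list_diag_prod)
  have detB: "det B = hankel_det n h"
    unfolding B_def hankel_det_def H_def[symmetric]
    by (subst det_four_block_mat_upper_right_zero[where n = 1 and m = n]) (use carr in auto)
  have "mat (Suc n) (Suc n) (\<lambda>(i, j). fps_nth e (i + j)) = L * B * transpose_mat L"
  proof (rule eq_matI)
    fix i j assume "i < dim_row (L * B * transpose_mat L)" "j < dim_col (L * B * transpose_mat L)"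
    then have ij: "i < Suc n" "j < Suc n"
      using carr by auto
    have LB: "(L * B) $$ (i, l) = (\<Sum>k<Suc n. L $$ (i, k) * B $$ (k, l))" if "l < Suc n" for l
      using carr ij that by (simp add: scalar_prod_def atLeast0LessThan)
    \<comment> \<open>Matrix products sum over all \<open>n\<close> indices; triangularity of
      \<open>L\<close> cuts these sums at \<open>i\<close> or \<open>j\<close>, where the bound
      \<open>m = n\<close> is allowed.\<close>
    have restrict: "(\<Sum>k<n. if k < m then F k else 0) = (\<Sum>k<m. F k)" if "m < Suc n" for m and F :: "nat \<Rightarrow> 'a"
      using that by (intro sum.mono_neutral_cong_right) auto
    have L_Suc: "L $$ (p, Suc k) = (if k < p then fps_nth e (p - 1 - k) else 0)"
      if "p < Suc n" "k < n" for p k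
      using that by (auto simp: L_def)
    have LB_0: "(L * B) $$ (i, 0) = fps_nth e i"
      using ij by (subst LB, simp, subst sum.lessThan_Suc_shift) (simp add: L_def B_def H_def)
    have LB_Suc: "(L * B) $$ (i, Suc l) = (\<Sum>a<i. fps_nth e (i - 1 - a) * fps_nth h (a + l))"
      if l: "l < n" for l
    proof -
      have "(L * B) $$ (i, Suc l) = (\<Sum>k<n. L $$ (i, Suc k) * fps_nth h (k + l))"
        using ij l by (subst LB, simp, subst sum.lessThan_Suc_shift) (simp add: B_def H_def)
      also have "\<dots> = (\<Sum>k<n. if k < i then fps_nth e (i - 1 - k) * fps_nth h (k + l) else 0)"
        using ij by (intro sum.cong) (auto simp: L_Suc)
      finally show ?thesis
        using restrict ij by simp
    qed
    have "(L * B * transpose_mat L) $$ (i, j) = (\<Sum>l<Suc n. (L * B) $$ (i, l) * L $$ (j, l))"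
      using carr ij
      by (simp add: scalar_prod_def atLeast0LessThan LB del: sum.lessThan_Suc assoc_mult_mat)
    also have "\<dots> = fps_nth e i * fps_nth e j + (\<Sum>l<n. (L * B) $$ (i, Suc l) * L $$ (j, Suc l))"
      using ij by (subst sum.lessThan_Suc_shift) (simp only: LB_0, simp add: L_def)
    also have "(\<Sum>l<n. (L * B) $$ (i, Suc l) * L $$ (j, Suc l)) =
        (\<Sum>l<n. if l < j then (\<Sum>a<i. fps_nth e (i - 1 - a) * fps_nth h (a + l)) * fps_nth e (j - 1 - l) else 0)"
      using ij by (intro sum.cong) (auto simp only: LB_Suc L_Suc lessThan_iff mult_zero_right split: if_splits)
    also have "\<dots> = (\<Sum>l<j. (\<Sum>a<i. fps_nth e (i - 1 - a) * fps_nth h (a + l)) * fps_nth e (j - 1 - l))"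
      using ij(2) by (rule restrict)
    also have "\<dots> = (\<Sum>a<i. \<Sum>b<j. fps_nth e (i - 1 - a) * fps_nth h (a + b) * fps_nth e (j - 1 - b))"
      by (subst sum.swap) (simp add: sum_distrib_right)
    finally have "(L * B * transpose_mat L) $$ (i, j) = fps_nth e (i + j)"
      unfolding fps_nth_add_J_step[OF e, of i j] .
    then show "mat (Suc n) (Suc n) (\<lambda>(i, j). fps_nth e (i + j)) $$ (i, j) = (L * B * transpose_mat L) $$ (i, j)"
      using ij by simp
  qed (use carr in auto)
  then have "hankel_det (Suc n) e = det (L * B * transpose_mat L)"
    by (simp only: hankel_det_def)
  also have "\<dots> = det L * det B * det L"
    using carr by (simp add: det_mult[of _ "Suc n"] det_transpose)
  finally show ?thesis
    by (simp add: detL detB)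
qed

section \<open>Hankel determinants as products of partial numerators\<close>

lemma hankel_det_const_mult: "hankel_det n (fps_const c * f) = c ^ n * hankel_det n f"
proof -
  have "mat n n (\<lambda>(i, j). fps_nth (fps_const c * f) (i + j)) = c \<cdot>\<^sub>m mat n n (\<lambda>(i, j). fps_nth f (i + j))"
    by (rule eq_matI) auto
  then show ?thesis
    by (simp add: hankel_det_def det_smult)
qed

text \<open>Here \<open>f\<close> is \<open>b\<close> times the inverse of its denominator, so each
  of the \<open>n + 1\<close> rows contributes one factor \<open>b\<close>.\<close>

lemma hankel_det_J_step:
  fixes f h :: "'a::field fps"
  assumes f: "f * (1 + fps_const c * fps_X - fps_X\<^sup>2 * h) = fps_const b"
  shows "hankel_det (Suc n) f = b ^ Suc n * hankel_det n h"
proof -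
  define D where "D = 1 + fps_const c * fps_X - fps_X\<^sup>2 * h"
  have "fps_nth D 0 \<noteq> 0"
    by (simp add: D_def power2_eq_square)
  then have inv: "inverse D * D = 1"
    by (rule inverse_mult_eq_1)
  have "f = f * D * inverse D"
    using inv by (simp add: ac_simps)
  then have "f = fps_const b * inverse D"
    using f by (simp add: D_def)
  then show ?thesis
    using hankel_det_inverse_J_step[OF inv[unfolded D_def]]
    by (simp only: hankel_det_const_mult D_def)
qed

text \<open>Descending one level shrinks the matrix by one, so \<open>v i\<close> is met at size
  \<open>n - i\<close>, which is its exponent.\<close>

lemma hankel_det_J_tails:
  fixes f :: "nat \<Rightarrow> 'a::field fps"
  assumes "\<And>i. f i * (1 + fps_const (u (Suc i)) * fps_X - fps_X\<^sup>2 * f (Suc i)) = fps_const (v i)"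
  shows "hankel_det n (f 0) = (\<Prod>i<n. v i ^ (n - i))"
  using assms
proof (induction n arbitrary: f u v)
  case 0
  show ?case by (simp add: hankel_det_0)
next
  case (Suc n)
  have "hankel_det n (f (Suc 0)) = (\<Prod>i<n. v (Suc i) ^ (n - i))"
    using Suc.IH[of "\<lambda>i. f (Suc i)" "\<lambda>i. u (Suc i)" "\<lambda>i. v (Suc i)"] Suc.prems[of "Suc _"] by simp
  then show ?case
    unfolding hankel_det_J_step[OF Suc.prems[of 0]]
    by (subst prod.lessThan_Suc_shift) simp
qed

lemma prod_power_diff_Suc:
  fixes v :: "nat \<Rightarrow> 'a::comm_monoid_mult"
  shows "(\<Prod>i<Suc n. v i ^ (Suc n - i)) = (\<Prod>i<n. v i ^ (n - i)) * (\<Prod>i<Suc n. v i)"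
proof -
  have "(\<Prod>i<n. v i ^ (Suc n - i)) = (\<Prod>i<n. v i ^ (n - i)) * (\<Prod>i<n. v i)"
    by (subst prod.distrib[symmetric]) (auto intro!: prod.cong simp: Suc_diff_le mult.commute)
  then show ?thesis
    by (simp add: ac_simps)
qed

text \<open>Since \<open>v (2 * k + 1) * v (2 * k + 2) = 1\<close>, the partial products
  \<open>p\<close> are \<open>1\<close> at odd lengths and \<alpha>\<open>(k + 1)\<close> /
  \<alpha>\<open>k\<close> at length \<open>2 * k + 2\<close>. These are the ratios of consecutive
  values of \<open>q\<close>.\<close>

lemma prod_power_diff_telescoping:
  fixes v \<alpha> :: "nat \<Rightarrow> 'a::field"
  assumes \<alpha>: "\<alpha> 0 = 1" "\<And>k. \<alpha> k \<noteq> 0"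
    and v: "v 0 = 1" "\<And>k. v (2 * k + 1) = \<alpha> (k + 1) / \<alpha> k" "\<And>k. v (2 * k + 2) = \<alpha> k / \<alpha> (k + 1)"
  shows "(\<Prod>i<2 * k. v i ^ (2 * k - i)) = \<alpha> k" "(\<Prod>i<2 * k + 1. v i ^ (2 * k + 1 - i)) = \<alpha> k"
proof -
  define p where "p n = (\<Prod>i<n. v i)" for n
  define q where "q n = (\<Prod>i<n. v i ^ (n - i))" for n
  have p_Suc: "p (Suc n) = p n * v n" for n
    by (simp add: p_def)
  have q_Suc: "q (Suc n) = q n * p (Suc n)" for n
    unfolding p_def q_def by (rule prod_power_diff_Suc)
  have p: "p (2 * k + 1) = 1" for k
  proof (induction k)
    case 0
    show ?case by (simp add: p_def v)
  next
    case (Suc k)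
    have "p (2 * Suc k + 1) = p (2 * k + 1) * v (2 * k + 1) * v (2 * k + 2)"
      using p_Suc[of "2 * k + 2"] p_Suc[of "2 * k + 1"] by simp
    then show ?case
      using Suc \<alpha>(2)[of k] \<alpha>(2)[of "k + 1"] by (simp only: v) simp
  qed
  have q_odd: "q (2 * k + 1) = q (2 * k)" for k
    using q_Suc[of "2 * k"] p[of k] by simp
  have "q (2 * k) = \<alpha> k" for k
  proof (induction k)
    case 0
    show ?case by (simp add: q_def \<alpha>)
  next
    case (Suc k)
    have "q (2 * Suc k) = q (2 * k + 1) * (p (2 * k + 1) * v (2 * k + 1))"
      using q_Suc[of "2 * k + 1"] p_Suc[of "2 * k + 1"] by simp
    also have "\<dots> = \<alpha> k * (\<alpha> (k + 1) / \<alpha> k)"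
      using Suc by (simp only: q_odd p v) simp
    finally show ?case
      using \<alpha>(2)[of k] by simp
  qed
  then show "(\<Prod>i<2 * k. v i ^ (2 * k - i)) = \<alpha> k" "(\<Prod>i<2 * k + 1. v i ^ (2 * k + 1 - i)) = \<alpha> k"
    using q_odd by (simp_all only: q_def)
qed

section \<open>The tails of the continued fraction\<close>

text \<open>Rationalising gives \<open>P - R = 4 x^4 / (P + R) = 2 x^4 V\<close>, which yields the
  quadratic equation for \<open>V\<close>. Defining \<open>V\<close> through \<open>P + R\<close>, a
  unit, avoids dividing by a power of \<open>x\<close>.\<close>

lemma sqrt_quotient_eq:
  fixes s y z :: "'a::field_char_0"
  assumes z: "z \<noteq> 0"
  defines "X \<equiv> fps_X :: 'a fps" and "S \<equiv> fps_const s" and "Y \<equiv> fps_const y" and "Z \<equiv> fps_const z"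
  obtains V where "V * (1 - S * X + X\<^sup>2 * Y - X ^ 4 * V) = 1"
    and "(- 2 * Z * X\<^sup>2 - (S * X - X\<^sup>2 * Y - 1)
        - fps_radical (\<lambda>_ _. 1) 2 ((S * X - X\<^sup>2 * Y - 1)\<^sup>2 - (2 * X\<^sup>2)\<^sup>2))
      / (2 * X\<^sup>2 * (X\<^sup>2 + X\<^sup>2 * Z\<^sup>2 + Z * (S * X - X\<^sup>2 * Y - 1))) = V * inverse (1 - Z * X\<^sup>2 * V)"
proof -
  define P where "P = 1 - S * X + X\<^sup>2 * Y"
  define R where "R = fps_radical (\<lambda>_ _. 1) 2 ((S * X - X\<^sup>2 * Y - 1)\<^sup>2 - (2 * X\<^sup>2)\<^sup>2)"
  define V where "V = 2 * inverse (P + R)"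
  define num where "num = - 2 * Z * X\<^sup>2 - (S * X - X\<^sup>2 * Y - 1) - R"
  define den where "den = 2 * X\<^sup>2 * (X\<^sup>2 + X\<^sup>2 * Z\<^sup>2 + Z * (S * X - X\<^sup>2 * Y - 1))"
  have c: "fps_nth ((S * X - X\<^sup>2 * Y - 1)\<^sup>2 - (2 * X\<^sup>2)\<^sup>2) 0 = 1"
    by (simp add: X_def S_def Y_def power2_eq_square)
  have R2: "R\<^sup>2 = (S * X - X\<^sup>2 * Y - 1)\<^sup>2 - (2 * X\<^sup>2)\<^sup>2" and R0: "fps_nth R 0 = 1"
    using sqrt_with_constant_term_1[OF c] by (simp_all add: R_def)
  have "fps_nth (P + R) 0 \<noteq> 0"
    by (simp add: R0 P_def X_def S_def Y_def power2_eq_square)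
  then have inv: "inverse (P + R) * (P + R) = 1"
    by (rule inverse_mult_eq_1)
  then have VPR: "V * (P + R) = 2"
    by (simp add: V_def mult.assoc)
  have "(P - R) * (P + R) = P\<^sup>2 - R\<^sup>2"
    by (simp add: power2_eq_square algebra_simps)
  also have "\<dots> = 4 * X ^ 4"
    unfolding R2 P_def by (simp add: power2_eq_square power4_eq_xxxx algebra_simps)
  finally have "(P - R) * ((P + R) * inverse (P + R)) = 2 * X ^ 4 * V"
    by (simp add: V_def ac_simps)
  then have PR: "P - R = 2 * X ^ 4 * V"
    using inv by (simp add: mult.commute)
  have "2 * (V * (P - X ^ 4 * V)) = V * (2 * P - (P - R))"
    unfolding PR by (simp add: algebra_simps)
  also have "\<dots> = 2 * 1"
    using VPR by (simp add: algebra_simps)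
  finally have V: "V * (P - X ^ 4 * V) = 1"
    by (simp only: mult_cancel_left) simp
  define W where "W = 1 - Z * X\<^sup>2 * V"
  have "fps_nth W 0 \<noteq> 0"
    by (simp add: W_def X_def power2_eq_square mult.assoc)
  then have invW: "W * inverse W = 1"
    by (rule inverse_mult_eq_1')
  have num: "num = 2 * X\<^sup>2 * (X\<^sup>2 * V - Z)"
    using PR by (simp add: num_def P_def power2_eq_square power4_eq_xxxx algebra_simps)
  \<comment> \<open>Multiplying by \<open>W\<close> creates a term in \<open>V^2\<close>; the
    quadratic equation makes it linear in \<open>V\<close>, and the constant terms cancel.\<close>
  have "num * W = 2 * X\<^sup>2 * (X\<^sup>2 * V + Z\<^sup>2 * X\<^sup>2 * V - Z - Z * (X ^ 4 * V * V))"
    unfolding num by (simp add: W_def power2_eq_square power4_eq_xxxx algebra_simps)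
  also have "X ^ 4 * V * V = V * P - 1"
    using V by (simp add: algebra_simps)
  also have "2 * X\<^sup>2 * (X\<^sup>2 * V + Z\<^sup>2 * X\<^sup>2 * V - Z - Z * (V * P - 1)) = den * V"
    by (simp add: den_def P_def algebra_simps)
  finally have "num * (W * inverse W) = den * (V * inverse W)"
    by (simp add: mult.assoc[symmetric])
  then have "num = den * (V * inverse W)"
    by (simp add: invW)
  \<comment> \<open>\<open>den\<close> is divisible by \<open>x^2\<close>, hence no unit; the
    quotient is found by cancelling a nonzero factor instead.\<close>
  moreover have "den \<noteq> 0"
    using g_quotient_exact(1)[OF z, of s y] by (simp add: den_def X_def S_def Y_def Z_def)
  ultimately have "num / den = V * inverse W"
    by simp
  then show thesis
    using that[OF V[unfolded P_def]] by (simp add: num_def den_def R_def W_def)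
qed

text \<open>The quadratic equation for \<open>V\<close> turns \<open>V\<close> times the new
  denominator into \<open>W\<close>. With \<open>I\<close> as inverse of \<open>W\<close>,
  \<open>V * I\<close> is \<open>G(Q + Y)\<close>.\<close>

lemma tail_even_step:
  fixes V X :: "'a::comm_ring_1"
  assumes "V * (1 - S * X + X\<^sup>2 * Y - X ^ 4 * V) = 1" and "W = 1 - (Q + Y) * X\<^sup>2 * V" and "W * I = 1"
  shows "V * I * (1 - S * X - X\<^sup>2 * (Q + X\<^sup>2 * V)) = 1"
proof -
  have "V * (1 - S * X - X\<^sup>2 * (Q + X\<^sup>2 * V)) = V * (1 - S * X + X\<^sup>2 * Y - X ^ 4 * V) - (Q + Y) * X\<^sup>2 * V"
    by (simp add: power2_eq_square power4_eq_xxxx algebra_simps)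
  also have "\<dots> = W"
    using assms by simp
  finally show ?thesis
    using assms(3) by (simp add: ac_simps)
qed

text \<open>\<open>W\<close> is the denominator of \<open>G(-Q')\<close> with
  \<open>Q' = 1 / Q\<close>, and the tail \<open>Q + x^2 V\<close> factors as
  \<open>Q * W\<close>.\<close>

lemma tail_odd_step:
  fixes V X :: "'a::comm_ring_1"
  assumes "Q * Q' = 1" and "W = 1 + Q' * X\<^sup>2 * V" and "W * I = 1"
  shows "(Q + X\<^sup>2 * V) * (1 - X\<^sup>2 * (Q' * (V * I))) = Q"
proof -
  have "Q * W = Q + (Q * Q') * (X\<^sup>2 * V)"
    by (simp add: assms(2) algebra_simps)
  then have QW: "Q + X\<^sup>2 * V = Q * W"
    using assms(1) by simp
  have "Q * W * (1 - X\<^sup>2 * (Q' * (V * I))) = Q * W - X\<^sup>2 * V * (Q * Q') * (W * I)"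
    by (simp add: algebra_simps)
  also have "\<dots> = Q * W - X\<^sup>2 * V"
    using assms by simp
  also have "\<dots> = Q"
    using QW by (simp add: algebra_simps)
  finally show ?thesis
    by (simp only: QW)
qed

text \<open>Coefficient comparison after clearing the denominator. Dividing the recurrence by
  \<alpha>\<open>(n + 1)\<close> will give \<open>r (n + 1) + y = - 1 / r n\<close>.\<close>

lemma alpha_recurrence:
  fixes \<alpha> :: "nat \<Rightarrow> 'a::field"
  assumes \<alpha>: "Abs_fps \<alpha> = (1 + fps_const z * fps_X) / (1 + fps_const y * fps_X + fps_X\<^sup>2)"
  shows "\<alpha> 0 = 1" "\<alpha> 1 = z - y" "\<alpha> (Suc (Suc n)) = - y * \<alpha> (Suc n) - \<alpha> n"
proof -
  let ?D = "1 + fps_const y * fps_X + fps_X\<^sup>2 :: 'a fps"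
  have "is_unit ?D"
    by (simp add: power2_eq_square)
  then have "Abs_fps \<alpha> * ?D = 1 + fps_const z * fps_X"
    unfolding \<alpha> by (metis dvd_div_mult_self unit_imp_dvd)
  then have eq: "Abs_fps \<alpha> + fps_X * (fps_const y * Abs_fps \<alpha>) + fps_X * (fps_X * Abs_fps \<alpha>) =
      1 + fps_X * fps_const z"
    by (simp add: algebra_simps power2_eq_square)
  note nth = arg_cong[OF eq, of "\<lambda>f. fps_nth f _"]
  show a0: "\<alpha> 0 = 1"
    using nth[of 0] by simp
  show "\<alpha> 1 = z - y"
    using nth[of 1] a0 by (simp add: eq_diff_eq)
  show "\<alpha> (Suc (Suc n)) = - y * \<alpha> (Suc n) - \<alpha> n"
    using nth[of "Suc (Suc n)"] by (simp add: eq_neg_iff_add_eq_0 algebra_simps)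
qed

theorem theorem3p3:
  fixes s y z :: "'a::field_char_0 poly poly poly fract"
    and \<alpha> u v :: "nat \<Rightarrow> 'a poly poly poly fract"
    and X S Y Z g :: "'a poly poly poly fract fps"
  assumes "s = indet_s" and "y = indet_y" and "z = indet_z"
    and "X = fps_X" and "S = fps_const s" and "Y = fps_const y" and "Z = fps_const z"
    and "Abs_fps \<alpha> = (1 + Z * X) / (1 + Y * X + X\<^sup>2)"
    and "g = (- 2 * Z * X\<^sup>2 - (S * X - X\<^sup>2 * Y - 1)
               - fps_radical (\<lambda>_ _. 1) 2 ((S * X - X\<^sup>2 * Y - 1)\<^sup>2 - (2 * X\<^sup>2)\<^sup>2))
             / (2 * X\<^sup>2 * (X\<^sup>2 + X\<^sup>2 * Z\<^sup>2 + Z * (S * X - X\<^sup>2 * Y - 1)))"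
    and "\<And>k. u (2 * k + 1) = - s"
    and "\<And>k. u (2 * k + 2) = 0"
    and "v 0 = 1"
    and "\<And>k. v (2 * k + 1) = \<alpha> (k + 1) / \<alpha> k"
    and "\<And>k. v (2 * k + 2) = \<alpha> k / \<alpha> (k + 1)"
  shows "g = J_fraction u v \<and>
    (\<forall>k. hankel_det (2 * k) g = \<alpha> k \<and> hankel_det (2 * k + 1) g = \<alpha> k)"
proof -
  note X = assms(4) and S = assms(5) and Y = assms(6) and Z = assms(7) and v = assms(12-14)
  have \<alpha>: "Abs_fps \<alpha> = (1 + fps_const z * fps_X) / (1 + fps_const y * fps_X + fps_X\<^sup>2)"
    using assms(8) by (simp only: X Y Z)
  note rec = alpha_recurrence[OF \<alpha>]
  have nz: "\<alpha> k \<noteq> 0" for k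
    by (rule alpha_nonzero) (use \<alpha> assms(2,3) in simp)
  have "z \<noteq> 0"
    using indet_z_nonzero assms(3) by simp
  then obtain V where V: "V * (1 - S * X + X\<^sup>2 * Y - X ^ 4 * V) = 1"
    and g: "g = V * inverse (1 - Z * X\<^sup>2 * V)"
    unfolding assms(9) X S Y Z by (rule sqrt_quotient_eq)
  define r where "r k = \<alpha> (k + 1) / \<alpha> k" for k
  define W where "W k = 1 - fps_const (r k + y) * X\<^sup>2 * V" for k
  \<comment> \<open>Even tails are \<open>v (2 * k)\<close> times \<open>G(r k + y)\<close>; odd
    tails are the remainders \<open>r k + x^2 V\<close> left by the even step.\<close>
  define f where "f i = (if even i then fps_const (v i) * (V * inverse (W (i div 2)))
      else fps_const (r (i div 2)) + X\<^sup>2 * V)" for i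
  have f_even: "f (2 * k) = fps_const (v (2 * k)) * (V * inverse (W k))"
    and f_odd: "f (2 * k + 1) = fps_const (r k) + X\<^sup>2 * V" for k
    by (simp_all add: f_def)
  \<comment> \<open>This identifies the parameter of the next even tail with the
    \<open>- 1 / r k\<close> that the odd step produces.\<close>
  have r_step: "r (Suc k) + y = - (\<alpha> k / \<alpha> (k + 1))" for k
    using nz[of "k + 1"] by (simp add: r_def rec(3) field_simps)
  have W_inv: "W k * inverse (W k) = 1" for k
    by (rule inverse_mult_eq_1') (simp add: W_def X power2_eq_square mult.assoc)
  have tails: "f i * (1 + fps_const (u (Suc i)) * fps_X - fps_X\<^sup>2 * f (Suc i)) = fps_const (v i)" for i
  proof (cases "even i")
    case True
    then obtain k where i: "i = 2 * k" by blast
    have "V * inverse (W k) * (1 - S * X - X\<^sup>2 * (fps_const (r k) + X\<^sup>2 * V)) = 1"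
      by (rule tail_even_step[OF V _ W_inv]) (simp add: W_def Y)
    moreover have "1 + fps_const (u (Suc i)) * X = 1 - S * X"
      using assms(10)[of k] by (simp add: i S flip: fps_const_neg)
    ultimately show ?thesis
      using f_odd[of k] by (simp add: i f_even mult.assoc flip: X)
  next
    case False
    then obtain k where i: "i = 2 * k + 1" by (auto elim: oddE)
    have "(fps_const (r k) + X\<^sup>2 * V) *
        (1 - X\<^sup>2 * (fps_const (v (2 * k + 2)) * (V * inverse (W (k + 1))))) = fps_const (r k)"
    proof (rule tail_odd_step[OF _ _ W_inv])
      show "fps_const (r k) * fps_const (v (2 * k + 2)) = 1"
        using nz[of k] nz[of "k + 1"] by (simp only: v r_def fps_const_mult) simp
      show "W (k + 1) = 1 + fps_const (v (2 * k + 2)) * X\<^sup>2 * V"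
        using r_step[of k] by (simp only: W_def v) (simp flip: fps_const_neg)
    qed
    then show ?thesis
      using f_even[of "k + 1"] f_odd[of k] assms(11)[of k] v(2)[of k] by (simp add: i r_def flip: X)
  qed
  \<comment> \<open>The first parameter is \<open>r 0 + y = z\<close>, and \<open>v 0 = 1\<close>
    leaves exactly \<open>G(z)\<close>.\<close>
  have "f 0 = g"
    using f_even[of 0] rec(1,2) by (simp add: g v W_def r_def Z)
  then show ?thesis
    using J_fraction_eqI[of f u v, OF tails] hankel_det_J_tails[of f u v, OF tails]
      prod_power_diff_telescoping[OF rec(1) nz v] by simp
qed

end
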